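(* Let $\Gamma$ be a connected bipartite graph with $a$ even vertices and $b$ odd vertices and no double edges, and let $\delta_{ij}\in\mathbb{R}_{>0}$ be a weighting of the edges $(i,j)\in\Gamma$ ($i$ even, $j$ odd). The following conditions are equivalent. (1) For any cycle $(i_1,j_1,i_2,j_2,\dots,i_n,j_n)$ in $\Gamma$, $\prod_{k=1}^n\delta_{i_kj_k}=\prod_{k=1}^n\delta_{i_{k+1}j_k}$, where indices are taken modulo $n$. (2) There is a weighting $\eta_i,\xi_j\in\mathbb{R}_{>0}$ of the even vertices $i$ and odd vertices $j$ of $\Gamma$ such that $\delta_{ij}=\xi_j/\eta_i$ for every edge $(i,j)\in\Gamma$. Moreover this weighting is unique up to simultaneous uniform scaling of all $\eta_i,\xi_j$. (3) There is an extension of $\delta$ to the complete bipartite graph $K_{a,b}$ satisfying $\delta_{ij}\delta_{i'j'}=\delta_{ij'}\delta_{i'j}$ for all $1\le i,i'\le a$ and $1\le j,j'\le b$. Moreover, any such extension is unique. (4) There is an extension of $\delta$ to a groupoid homomorphism $\mathcal{G}_{a+b}\to\mathbb{R}_{>0}$. Moreover, any such extension is unique.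
   Context: A cycle $(i_1,j_1,\dots,i_n,j_n)$ is a closed walk with $(i_k,j_k)$ and $(i_{k+1},j_k)$ edges of $\Gamma$ for all $k$ (indices mod $n$). $\mathcal{G}_{a+b}$ is the groupoid whose objects are the $a$ even and $b$ odd vertices with exactly one isomorphism between any two objects; a groupoid homomorphism to $\mathbb{R}_{>0}$ is a function $(r,s)\mapsto\delta_{rs}\in\mathbb{R}_{>0}$ on ordered pairs of objects with $\delta_{rs}\delta_{st}=\delta_{rt}$. The edge $(i,j)$ of $\Gamma$ is identified with the morphism from $i$ to $j$. *)

theory Defs
  imports Complex_Main "Graph_Theory.Graph_Theory"
begin

text \<open>
  Undirected simple graphs are the symmetric digraphs of \<open>Graph_Theory\<close>
  (\<open>pair_graph\<close>: finite, loop-free, and without double edges because the arcs form a set of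
  ordered pairs). The vertices come with a fixed bipartition into the set \<open>Ev\<close> of even and the
  set \<open>Od\<close> of odd vertices.
\<close>

definition bipartite_graph :: "'v set \<Rightarrow> 'v set \<Rightarrow> 'v pair_pre_digraph \<Rightarrow> bool" where
  "bipartite_graph Ev Od \<Gamma> \<longleftrightarrow>
     pair_graph \<Gamma> \<and> pverts \<Gamma> = Ev \<union> Od \<and> Ev \<inter> Od = {} \<and>
     parcs \<Gamma> \<subseteq> Ev \<times> Od \<union> Od \<times> Ev"

text \<open>Each undirected edge is represented once, as the pair (even end, odd end).\<close>

definition bip_edges :: "'v set \<Rightarrow> 'v set \<Rightarrow> 'v pair_pre_digraph \<Rightarrow> ('v \<times> 'v) set" where
  "bip_edges Ev Od \<Gamma> = parcs \<Gamma> \<inter> Ev \<times> Od"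

definition complete_bip :: "'v set \<Rightarrow> 'v set \<Rightarrow> 'v pair_pre_digraph" where
  "complete_bip Ev Od = \<lparr> pverts = Ev \<union> Od, parcs = Ev \<times> Od \<union> Od \<times> Ev \<rparr>"

lemma bipartite_graph_complete_bip:
  assumes "finite Ev" "finite Od" "Ev \<inter> Od = {}"
  shows "bipartite_graph Ev Od (complete_bip Ev Od)"
  using assms unfolding bipartite_graph_def complete_bip_def
  by (auto simp: arcs_ends_conv symmetric_def sym_def intro!: pair_graph.intro pair_digraph.intro
      pair_fin_digraph.intro pair_wf_digraph.intro pair_fin_digraph_axioms.intro
      pair_loopfree_digraph.intro pair_loopfree_digraph_axioms.intro
      pair_pseudo_graph.intro pair_sym_digraph.intro pair_sym_digraph_axioms.intro)

lemma complete_bip_is_K: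
  assumes "finite Ev" "finite Od" "Ev \<inter> Od = {}"
  shows "K\<^bsub>card Ev, card Od\<^esub> (with_proj (complete_bip Ev Od))"
  unfolding complete_bipartite_digraph_pair_def
  using assms by (auto simp: complete_bip_def)

lemma bip_edges_complete_bip:
  "bip_edges Ev Od (complete_bip Ev Od) = Ev \<times> Od"
  by (auto simp: bip_edges_def complete_bip_def)

definition edge_weighting :: "('v \<times> 'v) set \<Rightarrow> ('v \<Rightarrow> 'v \<Rightarrow> real) \<Rightarrow> bool" where
  "edge_weighting E \<delta> \<longleftrightarrow> (\<forall>(i, j) \<in> E. \<delta> i j > 0)"

definition extends :: "('v \<times> 'v) set \<Rightarrow> ('v \<Rightarrow> 'v \<Rightarrow> real) \<Rightarrow> ('v \<Rightarrow> 'v \<Rightarrow> real) \<Rightarrow> bool" where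
  "extends E \<delta> D \<longleftrightarrow> (\<forall>(i, j) \<in> E. D i j = \<delta> i j)"

text \<open>
  The cycle \<open>(i 0, j 0, i 1, j 1, \<dots>, i (n - 1), j (n - 1))\<close>: a closed walk, whose
  vertices and edges may repeat.
\<close>

definition bip_cycle :: "('v \<times> 'v) set \<Rightarrow> nat \<Rightarrow> (nat \<Rightarrow> 'v) \<Rightarrow> (nat \<Rightarrow> 'v) \<Rightarrow> bool" where
  "bip_cycle E n i j \<longleftrightarrow>
     n \<ge> 1 \<and> (\<forall>k<n. (i k, j k) \<in> E \<and> (i (Suc k mod n), j k) \<in> E)"

definition vertex_potential ::
  "'v set \<Rightarrow> 'v set \<Rightarrow> 'v pair_pre_digraph \<Rightarrow> ('v \<Rightarrow> 'v \<Rightarrow> real) \<Rightarrow>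
   ('v \<Rightarrow> real) \<Rightarrow> ('v \<Rightarrow> real) \<Rightarrow> bool" where
  "vertex_potential Ev Od \<Gamma> \<delta> \<eta> \<xi> \<longleftrightarrow>
     (\<forall>i\<in>Ev. \<eta> i > 0) \<and> (\<forall>j\<in>Od. \<xi> j > 0) \<and>
     (\<forall>(i, j) \<in> bip_edges Ev Od \<Gamma>. \<delta> i j = \<xi> j / \<eta> i)"

definition complete_extension ::
  "'v set \<Rightarrow> 'v set \<Rightarrow> 'v pair_pre_digraph \<Rightarrow> ('v \<Rightarrow> 'v \<Rightarrow> real) \<Rightarrow>
   ('v \<Rightarrow> 'v \<Rightarrow> real) \<Rightarrow> bool" where
  "complete_extension Ev Od \<Gamma> \<delta> d \<longleftrightarrow>
     edge_weighting (bip_edges Ev Od (complete_bip Ev Od)) d \<and>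
     extends (bip_edges Ev Od \<Gamma>) \<delta> d \<and>
     (\<forall>i\<in>Ev. \<forall>i'\<in>Ev. \<forall>j\<in>Od. \<forall>j'\<in>Od. d i j * d i' j' = d i j' * d i' j)"

text \<open>
  The groupoid with object set \<open>V\<close> and exactly one isomorphism between any two objects has the
  ordered pairs \<open>(r, s)\<close> of objects as its morphisms \<open>r \<rightarrow> s\<close>; \<open>D r s\<close> is the image of that morphism.
\<close>

definition groupoid_hom :: "'v set \<Rightarrow> ('v \<Rightarrow> 'v \<Rightarrow> real) \<Rightarrow> bool" where
  "groupoid_hom V D \<longleftrightarrow>
     (\<forall>r\<in>V. \<forall>s\<in>V. D r s > 0) \<and>
     (\<forall>r\<in>V. \<forall>s\<in>V. \<forall>t\<in>V. D r s * D s t = D r t)"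

definition groupoid_extension ::
  "'v set \<Rightarrow> 'v set \<Rightarrow> 'v pair_pre_digraph \<Rightarrow> ('v \<Rightarrow> 'v \<Rightarrow> real) \<Rightarrow>
   ('v \<Rightarrow> 'v \<Rightarrow> real) \<Rightarrow> bool" where
  "groupoid_extension Ev Od \<Gamma> \<delta> D \<longleftrightarrow>
     groupoid_hom (Ev \<union> Od) D \<and> extends (bip_edges Ev Od \<Gamma>) \<delta> D"

definition cycle_condition ::
  "'v set \<Rightarrow> 'v set \<Rightarrow> 'v pair_pre_digraph \<Rightarrow> ('v \<Rightarrow> 'v \<Rightarrow> real) \<Rightarrow> bool" where
  "cycle_condition Ev Od \<Gamma> \<delta> \<longleftrightarrow>
     (\<forall>n i j. bip_cycle (bip_edges Ev Od \<Gamma>) n i j \<longrightarrow>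
        (\<Prod>k<n. \<delta> (i k) (j k)) = (\<Prod>k<n. \<delta> (i (Suc k mod n)) (j k)))"

end

theory Submission
  imports Defs
begin

text \<open>
  Normalise \<open>\<eta>\<close> to be \<open>1\<close> at a root \<open>r \<in> Ev\<close>. A step \<open>i - j - i'\<close> forces
  \<open>\<eta> i' = \<eta> i * \<delta> i j / \<delta> i' j\<close>, so \<open>\<eta> i\<close> is the weight of any walk from \<open>r\<close> to \<open>i\<close>, and
  the cycle condition says precisely that this weight depends on \<open>i\<close> only. A weighting of the
  vertices yields the groupoid homomorphism sending \<open>(r, s)\<close> to the quotient of the weights of \<open>s\<close> and
  \<open>r\<close>; conversely an extension to the complete bipartite graph yields a weighting by fixing one
  vertex on each side. All uniqueness claims reduce to the one for vertex weightings, where the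
  ratio of two weightings is constant along edges.
\<close>

section \<open>Propagation along the edges of a connected bipartite graph\<close>

text \<open>The edge premise is an equivalence because an edge is stored only as the pair (even,
  odd), while a walk may cross it in either direction.\<close>

lemma bipartite_connected_induct [consumes 4, case_names root edge]:
  assumes "bipartite_graph Ev Od \<Gamma>" "Digraph_Component.connected (with_proj \<Gamma>)"
    and "r \<in> Ev \<union> Od" "v \<in> Ev \<union> Od"
    and root: "P r"
    and edge: "\<And>i j. (i, j) \<in> bip_edges Ev Od \<Gamma> \<Longrightarrow> P i \<longleftrightarrow> P j"
  shows "P v"
proof -
  have sub: "parcs \<Gamma> \<subseteq> Ev \<times> Od \<union> Od \<times> Ev" and verts: "pverts \<Gamma> = Ev \<union> Od"
    and graph: "pair_graph \<Gamma>"
    using assms(1) by (simp_all add: bipartite_graph_def)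
  have "symmetric (with_proj \<Gamma>)"
    using graph [THEN pair_graph.axioms(2), THEN pair_pseudo_graph.axioms(2)]
    by (rule pair_sym_digraph.pair_sym_arcs)
  then have "(y, x) \<in> parcs \<Gamma>" if "(x, y) \<in> parcs \<Gamma>" for x y
    using that by (simp add: symmetric_def sym_def)
  \<comment> \<open>An arc from odd to even is not in \<open>bip_edges\<close>, but by symmetry its
    reverse is.\<close>
  with sub have sc: "symcl (parcs \<Gamma>) \<subseteq> bip_edges Ev Od \<Gamma> \<union> (bip_edges Ev Od \<Gamma>)\<inverse>"
    by (auto simp: bip_edges_def symcl_def)
  have "(r, v) \<in> rtrancl_on (pverts \<Gamma>) (symcl (parcs \<Gamma>))"
    using assms(2-4) verts by (simp add: connected_conv)
  then show ?thesis
  proof (induction rule: rtrancl_on_induct)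
    case base
    show ?case by (fact root)
  next
    case (step x y)
    with sc have "(x, y) \<in> bip_edges Ev Od \<Gamma> \<or> (y, x) \<in> bip_edges Ev Od \<Gamma>" by blast
    with edge \<open>P x\<close> show ?case by blast
  qed
qed

section \<open>Weights of walks between even vertices\<close>

text \<open>The weight is an argument of the relation, since without the cycle condition it may
  depend on the walk and not just on its ends.\<close>

inductive even_walk :: "('v \<times> 'v) set \<Rightarrow> ('v \<Rightarrow> 'v \<Rightarrow> real) \<Rightarrow> 'v \<Rightarrow> 'v \<Rightarrow> real \<Rightarrow> bool"
  for E \<delta> r where
  refl: "even_walk E \<delta> r r 1"
| step: "even_walk E \<delta> r i x \<Longrightarrow> (i, j) \<in> E \<Longrightarrow> (i', j) \<in> E \<Longrightarrow>
    even_walk E \<delta> r i' (x * (\<delta> i j / \<delta> i' j))"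

lemma even_walk_trans:
  assumes "even_walk E \<delta> s t y" "even_walk E \<delta> r s x"
  shows "even_walk E \<delta> r t (x * y)"
  using assms
proof (induction rule: even_walk.induct)
  case refl
  then show ?case by simp
next
  case (step i y j i')
  then show ?case
    using even_walk.step [of E \<delta> r i "x * y" j i'] by (simp add: mult.assoc)
qed

lemma even_walk_sym: "even_walk E \<delta> r s x \<Longrightarrow> even_walk E \<delta> s r (1 / x)"
proof (induction rule: even_walk.induct)
  case refl
  show ?case by (simp add: even_walk.refl)
next
  case (step i x j i')
  \<comment> \<open>Steps can only be appended at the end, so the last step, reversed, becomes a
    one-step walk to be put in front by transitivity.\<close>
  have "even_walk E \<delta> i' i (1 * (\<delta> i' j / \<delta> i j))"
    using step.hyps even_walk.refl by (intro even_walk.step)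
  with step.IH have "even_walk E \<delta> i' r (1 * (\<delta> i' j / \<delta> i j) * (1 / x))"
    by (rule even_walk_trans)
  then show ?case by (simp add: mult.commute)
qed

lemma even_walk_pos:
  assumes "edge_weighting E \<delta>"
  shows "even_walk E \<delta> r s x \<Longrightarrow> x > 0"
proof (induction rule: even_walk.induct)
  case refl
  show ?case by simp
next
  case (step i x j i')
  then have "\<delta> i j > 0" "\<delta> i' j > 0"
    using assms by (fastforce simp: edge_weighting_def)+
  with step.IH show ?case by simp
qed

text \<open>Turns the inductive walk into indexed sequences, the form in which
  \<open>bip_cycle\<close> and the cycle condition are stated.\<close>

lemma even_walk_sequences:
  assumes "even_walk E \<delta> r s x"
  obtains n i j where "i 0 = r" "i n = s"
    "\<And>k. k < n \<Longrightarrow> (i k, j k) \<in> E \<and> (i (Suc k), j k) \<in> E"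
    "x = (\<Prod>k<n. \<delta> (i k) (j k) / \<delta> (i (Suc k)) (j k))"
proof -
  have "\<exists>n i j. i 0 = r \<and> i n = s \<and> (\<forall>k<n. (i k, j k) \<in> E \<and> (i (Suc k), j k) \<in> E) \<and>
      x = (\<Prod>k<n. \<delta> (i k) (j k) / \<delta> (i (Suc k)) (j k))"
    using assms
  proof (induction rule: even_walk.induct)
    case refl
    \<comment> \<open>The empty walk: the constant function also serves as \<open>j\<close>, whose
      values are never read.\<close>
    show ?case by (intro exI [of _ "0::nat"] exI [of _ "\<lambda>_. r"]) simp
  next
    case (step s x t s')
    then obtain n i j where n: "i 0 = r" "i n = s"
      "\<And>k. k < n \<Longrightarrow> (i k, j k) \<in> E \<and> (i (Suc k), j k) \<in> E"
      "x = (\<Prod>k<n. \<delta> (i k) (j k) / \<delta> (i (Suc k)) (j k))" by blast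
    \<comment> \<open>Position \<open>Suc n\<close> of \<open>i\<close> and position
      \<open>n\<close> of \<open>j\<close> do not occur in the product so far, so the first
      \<open>n\<close> factors survive unchanged.\<close>
    define i' where "i' = i(Suc n := s')"
    define j' where "j' = j(n := t)"
    have "i' 0 = r" "i' (Suc n) = s'"
      using n by (auto simp: i'_def)
    moreover have "\<forall>k<Suc n. (i' k, j' k) \<in> E \<and> (i' (Suc k), j' k) \<in> E"
      using n step.hyps by (auto simp: i'_def j'_def less_Suc_eq)
    moreover have "x * (\<delta> s t / \<delta> s' t) =
        (\<Prod>k<Suc n. \<delta> (i' k) (j' k) / \<delta> (i' (Suc k)) (j' k))"
    proof -
      have "(\<Prod>k<n. \<delta> (i' k) (j' k) / \<delta> (i' (Suc k)) (j' k)) = x"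
        unfolding n by (rule prod.cong) (auto simp: i'_def j'_def)
      then show ?thesis using n by (simp add: i'_def j'_def)
    qed
    ultimately show ?case by blast
  qed
  then show thesis using that by blast
qed

text \<open>A closed walk of positive length is a cycle, and its weight is the quotient of the two
  products that the cycle condition equates.\<close>

lemma closed_even_walk_weight:
  assumes "cycle_condition Ev Od \<Gamma> \<delta>" "edge_weighting (bip_edges Ev Od \<Gamma>) \<delta>"
    and "even_walk (bip_edges Ev Od \<Gamma>) \<delta> r r x"
  shows "x = 1"
proof -
  let ?E = "bip_edges Ev Od \<Gamma>"
  from assms(3) obtain n i j where closed: "i 0 = r" "i n = r"
    and E: "\<And>k. k < n \<Longrightarrow> (i k, j k) \<in> ?E \<and> (i (Suc k), j k) \<in> ?E"
    and x: "x = (\<Prod>k<n. \<delta> (i k) (j k) / \<delta> (i (Suc k)) (j k))"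
    by (rule even_walk_sequences) blast
  show ?thesis
  proof (cases "n = 0")
    case True
    with x show ?thesis by simp
  next
    case False
    \<comment> \<open>Only the last index wraps around, and there \<open>i n = i 0\<close>.\<close>
    have mod: "i (Suc k mod n) = i (Suc k)" if "k < n" for k
      using that closed by (cases "Suc k = n") auto
    have "bip_cycle ?E n i j"
      using False E mod by (auto simp: bip_cycle_def)
    then have "(\<Prod>k<n. \<delta> (i k) (j k)) = (\<Prod>k<n. \<delta> (i (Suc k mod n)) (j k))"
      using assms(1) by (auto simp: cycle_condition_def)
    also have "\<dots> = (\<Prod>k<n. \<delta> (i (Suc k)) (j k))"
      by (rule prod.cong) (auto simp: mod)
    finally have "(\<Prod>k<n. \<delta> (i k) (j k)) = (\<Prod>k<n. \<delta> (i (Suc k)) (j k))" .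
    moreover have "(\<Prod>k<n. \<delta> (i (Suc k)) (j k)) > 0"
      using E assms(2) by (intro prod_pos) (fastforce simp: edge_weighting_def)
    ultimately show ?thesis
      unfolding x prod_dividef by (metis divide_self_if less_irrefl)
  qed
qed

text \<open>Out along one walk and back along the other is a closed walk of weight
  \<open>x / y\<close>.\<close>

lemma even_walk_weight_unique:
  assumes "cycle_condition Ev Od \<Gamma> \<delta>" and pos: "edge_weighting (bip_edges Ev Od \<Gamma>) \<delta>"
    and x: "even_walk (bip_edges Ev Od \<Gamma>) \<delta> r s x"
    and y: "even_walk (bip_edges Ev Od \<Gamma>) \<delta> r s y"
  shows "x = y"
proof -
  have "x * (1 / y) = 1"
    using assms(1,2) even_walk_trans [OF even_walk_sym [OF y] x]
    by (rule closed_even_walk_weight)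
  then show ?thesis using even_walk_pos [OF pos y] by simp
qed

section \<open>Cycle condition and vertex weightings\<close>

lemma cycle_condition_imp_vertex_potential:
  assumes bip: "bipartite_graph Ev Od \<Gamma>"
    and conn: "Digraph_Component.connected (with_proj \<Gamma>)"
    and pos: "edge_weighting (bip_edges Ev Od \<Gamma>) \<delta>"
    and cyc: "cycle_condition Ev Od \<Gamma> \<delta>"
  shows "\<exists>\<eta> \<xi>. vertex_potential Ev Od \<Gamma> \<delta> \<eta> \<xi>"
proof (cases "Ev = {}")
  case True
  then have "vertex_potential Ev Od \<Gamma> \<delta> (\<lambda>_. 1) (\<lambda>_. 1)"
    by (auto simp: vertex_potential_def bip_edges_def)
  then show ?thesis by blast
next
  case False
  then obtain r where r: "r \<in> Ev" by blast
  let ?E = "bip_edges Ev Od \<Gamma>"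
  have disj: "Ev \<inter> Od = {}" using bip by (simp add: bipartite_graph_def)
  have E: "i \<in> Ev \<and> j \<in> Od \<and> \<delta> i j > 0" if "(i, j) \<in> ?E" for i j
    using that pos unfolding edge_weighting_def by (auto simp: bip_edges_def)
  \<comment> \<open>Walks end at even vertices, so for an odd vertex the induction carries a
    reachable neighbour instead. This also gives every odd vertex an edge, from which
    \<open>\<xi>\<close> gets its value.\<close>
  have walk_exists: "(v \<in> Ev \<longrightarrow> (\<exists>x. even_walk ?E \<delta> r v x)) \<and>
      (v \<in> Od \<longrightarrow> (\<exists>i x. (i, v) \<in> ?E \<and> even_walk ?E \<delta> r i x))" if "v \<in> Ev \<union> Od" for v
    using bip conn UnI1 [OF r] that
  proof (induction rule: bipartite_connected_induct)
    case root
    have "r \<notin> Od" using r disj by blast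
    then show ?case using even_walk.refl [of ?E \<delta> r] by auto
  next
    case (edge i j)
    have ij: "i \<in> Ev" "i \<notin> Od" "j \<in> Od" "j \<notin> Ev" using E [OF edge] disj by auto
    have "(\<exists>x. even_walk ?E \<delta> r i x) \<longleftrightarrow> (\<exists>i x. (i, j) \<in> ?E \<and> even_walk ?E \<delta> r i x)"
      using edge even_walk.step [of ?E \<delta> r] by meson
    with ij show ?case by simp
  qed
  \<comment> \<open>On \<open>Ev\<close> the description is proper: a walk exists by connectedness,
    and its weight is unique by the cycle condition.\<close>
  define \<eta> where "\<eta> i = (THE x. even_walk ?E \<delta> r i x)" for i
  have \<eta>: "\<eta> i = x" if "even_walk ?E \<delta> r i x" for i x
    unfolding \<eta>_def using that even_walk_weight_unique [OF cyc pos] by blast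
  have \<eta>_walk: "even_walk ?E \<delta> r i (\<eta> i)" if "i \<in> Ev" for i
    using walk_exists that \<eta> by blast
  have \<eta>_pos: "\<eta> i > 0" if "i \<in> Ev" for i
    using \<eta>_walk [OF that] by (rule even_walk_pos [OF pos])
  have step: "\<eta> i' * \<delta> i' j = \<eta> i * \<delta> i j" if "(i, j) \<in> ?E" "(i', j) \<in> ?E" for i i' j
    using \<eta> [OF even_walk.step [OF \<eta>_walk that]] E that by force
  \<comment> \<open>By \<open>step\<close>, every neighbour of \<open>j\<close> yields the same
    value.\<close>
  define \<xi> where "\<xi> j = (let i = SOME i. (i, j) \<in> ?E in \<eta> i * \<delta> i j)" for j
  have \<xi>: "\<xi> j = \<eta> i * \<delta> i j" if "(i, j) \<in> ?E" for i j
    unfolding \<xi>_def Let_def using that someI [of "\<lambda>i. (i, j) \<in> ?E" i] by (intro step) auto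
  have "vertex_potential Ev Od \<Gamma> \<delta> \<eta> \<xi>"
    unfolding vertex_potential_def
  proof (intro conjI ballI)
    fix j assume "j \<in> Od"
    then obtain i where "(i, j) \<in> ?E" using walk_exists by blast
    then show "\<xi> j > 0" using \<xi> E \<eta>_pos by simp
  next
    show "case e of (i, j) \<Rightarrow> \<delta> i j = \<xi> j / \<eta> i" if "e \<in> ?E" for e
      using that \<xi> E \<eta>_pos by (cases e) fastforce
  qed (rule \<eta>_pos)
  then show ?thesis by blast
qed

text \<open>After substituting \<open>\<xi> / \<eta>\<close> for \<open>\<delta>\<close>, the
  numerators of the two products agree and the denominators differ by a cyclic shift of the
  indices.\<close>

lemma vertex_potential_imp_cycle_condition:
  assumes "vertex_potential Ev Od \<Gamma> \<delta> \<eta> \<xi>"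
  shows "cycle_condition Ev Od \<Gamma> \<delta>"
  unfolding cycle_condition_def
proof (intro allI impI)
  fix n and i j :: "nat \<Rightarrow> 'a"
  assume "bip_cycle (bip_edges Ev Od \<Gamma>) n i j"
  then have n: "n \<ge> 1" and \<delta>: "\<And>k. k < n \<Longrightarrow> \<delta> (i k) (j k) = \<xi> (j k) / \<eta> (i k) \<and>
      \<delta> (i (Suc k mod n)) (j k) = \<xi> (j k) / \<eta> (i (Suc k mod n))"
    using assms by (auto simp: bip_cycle_def vertex_potential_def)
  have rotate: "(\<Prod>k<n. \<eta> (i (Suc k mod n))) = (\<Prod>k<n. \<eta> (i k))"
  proof -
    obtain m where m: "n = Suc m" using n by (cases n) auto
    have "(\<Prod>k<m. \<eta> (i (Suc k mod n))) = (\<Prod>k<m. \<eta> (i (Suc k)))"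
      by (rule prod.cong) (auto simp: m)
    then show ?thesis
      using prod.lessThan_Suc_shift [of "\<lambda>k. \<eta> (i k)" m]
      by (simp add: m mult.commute)
  qed
  have "(\<Prod>k<n. \<delta> (i k) (j k)) = (\<Prod>k<n. \<xi> (j k)) / (\<Prod>k<n. \<eta> (i k))"
    by (simp add: \<delta> prod_dividef cong: prod.cong_simp)
  also have "\<dots> = (\<Prod>k<n. \<delta> (i (Suc k mod n)) (j k))"
    by (simp add: \<delta> rotate prod_dividef cong: prod.cong_simp)
  finally show "(\<Prod>k<n. \<delta> (i k) (j k)) = (\<Prod>k<n. \<delta> (i (Suc k mod n)) (j k))" .
qed

lemma vertex_potential_unique:
  assumes bip: "bipartite_graph Ev Od \<Gamma>"
    and conn: "Digraph_Component.connected (with_proj \<Gamma>)"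
    and p: "vertex_potential Ev Od \<Gamma> \<delta> \<eta> \<xi>"
    and p': "vertex_potential Ev Od \<Gamma> \<delta> \<eta>' \<xi>'"
  shows "\<exists>c>0. (\<forall>i\<in>Ev. \<eta>' i = c * \<eta> i) \<and> (\<forall>j\<in>Od. \<xi>' j = c * \<xi> j)"
proof (cases "Ev \<union> Od = {}")
  case True
  then show ?thesis by (auto intro: exI [of _ 1])
next
  case False
  then obtain r where r: "r \<in> Ev \<union> Od" by blast
  have disj: "Ev \<inter> Od = {}" using bip by (simp add: bipartite_graph_def)
  \<comment> \<open>Merging the even and odd ratios into one vertex function lets the induction
    along edges show it constant; the scaling factor is its value at \<open>r\<close>.\<close>
  define q where "q v = (if v \<in> Ev then \<eta>' v / \<eta> v else \<xi>' v / \<xi> v)" for v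
  have pos: "\<And>i. i \<in> Ev \<Longrightarrow> \<eta> i > 0 \<and> \<eta>' i > 0" "\<And>j. j \<in> Od \<Longrightarrow> \<xi> j > 0 \<and> \<xi>' j > 0"
    using p p' by (auto simp: vertex_potential_def)
  have edge: "q i = q j" if "(i, j) \<in> bip_edges Ev Od \<Gamma>" for i j
  proof -
    have ij: "i \<in> Ev" "j \<in> Od" using that by (auto simp: bip_edges_def)
    have "\<xi> j / \<eta> i = \<xi>' j / \<eta>' i"
      using p p' that by (fastforce simp: vertex_potential_def)
    then show ?thesis using pos(1) [OF ij(1)] pos(2) [OF ij(2)] ij disj
      by (auto simp: q_def field_simps)
  qed
  have q: "q v = q r" if "v \<in> Ev \<union> Od" for v
    using bip conn r that by (induction rule: bipartite_connected_induct) (simp_all add: edge)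
  have "\<eta>' i = q r * \<eta> i" if "i \<in> Ev" for i
    using q [of i] that pos(1) [of i] by (simp add: q_def field_simps)
  moreover have "\<xi>' j = q r * \<xi> j" if "j \<in> Od" for j
  proof -
    have "j \<notin> Ev" using that disj by blast
    then have "\<xi>' j / \<xi> j = q r" using q [of j] that by (simp add: q_def)
    then show ?thesis using pos(2) [OF that] by (simp add: field_simps)
  qed
  moreover have "q r > 0" using r pos by (auto simp: q_def)
  ultimately show ?thesis by blast
qed

section \<open>Extensions to the groupoid and to the complete bipartite graph\<close>

text \<open>The quotients telescope under composition.\<close>

lemma groupoid_hom_potential:
  assumes "\<And>v. v \<in> V \<Longrightarrow> p v > 0"
  shows "groupoid_hom V (\<lambda>r s. p s / p r)"
  using assms by (force simp: groupoid_hom_def)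

lemma vertex_potential_imp_groupoid_extension:
  assumes "Ev \<inter> Od = {}" "vertex_potential Ev Od \<Gamma> \<delta> \<eta> \<xi>"
  shows "\<exists>D. groupoid_extension Ev Od \<Gamma> \<delta> D"
proof -
  \<comment> \<open>Since \<open>Ev\<close> and \<open>Od\<close> are disjoint, this glues both
    weightings into one function on all vertices.\<close>
  define p where "p v = (if v \<in> Ev then \<eta> v else \<xi> v)" for v
  have "groupoid_hom (Ev \<union> Od) (\<lambda>r s. p s / p r)"
    by (rule groupoid_hom_potential) (use assms in \<open>auto simp: p_def vertex_potential_def\<close>)
  moreover have "extends (bip_edges Ev Od \<Gamma>) \<delta> (\<lambda>r s. p s / p r)"
    unfolding extends_def
  proof (clarify)
    fix i j assume ij: "(i, j) \<in> bip_edges Ev Od \<Gamma>"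
    then have "i \<in> Ev" "j \<notin> Ev" using assms(1) by (auto simp: bip_edges_def)
    moreover have "\<delta> i j = \<xi> j / \<eta> i"
      using assms(2) ij unfolding vertex_potential_def by blast
    ultimately show "p j / p i = \<delta> i j" by (simp add: p_def)
  qed
  ultimately show ?thesis by (auto simp: groupoid_extension_def)
qed

lemma groupoid_extension_imp_complete_extension:
  assumes "groupoid_extension Ev Od \<Gamma> \<delta> D"
  shows "complete_extension Ev Od \<Gamma> \<delta> D"
  unfolding complete_extension_def
proof (intro conjI ballI)
  have pos: "D r s > 0" if "r \<in> Ev \<union> Od" "s \<in> Ev \<union> Od" for r s
    using assms that by (auto simp: groupoid_extension_def groupoid_hom_def)
  have comp: "D r s * D s t = D r t" if "r \<in> Ev \<union> Od" "s \<in> Ev \<union> Od" "t \<in> Ev \<union> Od" for r s t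
    using assms that unfolding groupoid_extension_def groupoid_hom_def by blast
  show "edge_weighting (bip_edges Ev Od (complete_bip Ev Od)) D"
    using pos by (auto simp: edge_weighting_def bip_edges_complete_bip)
  show "extends (bip_edges Ev Od \<Gamma>) \<delta> D"
    using assms by (simp add: groupoid_extension_def)
  fix i i' j j' assume v: "i \<in> Ev" "i' \<in> Ev" "j \<in> Od" "j' \<in> Od"
  \<comment> \<open>The morphism from \<open>i\<close> to \<open>j\<close> is routed through
    \<open>j'\<close>; the factor \<open>D j' j\<close> then moves over to the morphism starting at
    \<open>i'\<close>.\<close>
  have "D i j * D i' j' = (D i j' * D j' j) * D i' j'"
    using v by (simp add: comp)
  also have "\<dots> = D i j' * (D i' j' * D j' j)" by (simp add: mult_ac)
  also have "\<dots> = D i j' * D i' j" using v by (simp add: comp)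
  finally show "D i j * D i' j' = D i j' * D i' j" .
qed

text \<open>All 2 by 2 minors of the matrix \<open>d\<close> vanish, so it has rank at most one and
  is recovered from one row and one column. The factorisation holds at all pairs, not only at edges
  of \<open>\<Gamma>\<close>, which is what uniqueness of \<open>d\<close> requires.\<close>

lemma complete_extension_imp_vertex_potential:
  assumes "complete_extension Ev Od \<Gamma> \<delta> d"
  obtains \<eta> \<xi> where "vertex_potential Ev Od \<Gamma> \<delta> \<eta> \<xi>"
    "\<And>i j. i \<in> Ev \<Longrightarrow> j \<in> Od \<Longrightarrow> d i j = \<xi> j / \<eta> i"
proof (cases "Ev = {} \<or> Od = {}")
  case True
  then have "vertex_potential Ev Od \<Gamma> \<delta> (\<lambda>_. 1) (\<lambda>_. 1)"
    by (auto simp: vertex_potential_def bip_edges_def)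
  then show thesis using True by (intro that [of "\<lambda>_. 1" "\<lambda>_. 1"]) auto
next
  case False
  then obtain i0 j0 where 0: "i0 \<in> Ev" "j0 \<in> Od" by blast
  have pos: "d i j > 0" if "i \<in> Ev" "j \<in> Od" for i j
    using assms that
    by (auto simp: complete_extension_def edge_weighting_def bip_edges_complete_bip)
  \<comment> \<open>Column \<open>j0\<close> gives \<open>\<eta>\<close> and row \<open>i0\<close>
    gives \<open>\<xi>\<close>, scaled so that \<open>\<xi> j0 = 1\<close>.\<close>
  define \<eta> where "\<eta> i = 1 / d i j0" for i
  define \<xi> where "\<xi> j = d i0 j / d i0 j0" for j
  have eq: "d i j = \<xi> j / \<eta> i" if "i \<in> Ev" "j \<in> Od" for i j
  proof -
    have "d i j * d i0 j0 = d i j0 * d i0 j"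
      using assms that 0 by (simp add: complete_extension_def)
    then show ?thesis using pos [OF 0] by (simp add: \<eta>_def \<xi>_def field_simps)
  qed
  have ext: "\<delta> i j = d i j" if "(i, j) \<in> bip_edges Ev Od \<Gamma>" for i j
    using assms that by (fastforce simp: complete_extension_def extends_def)
  have "vertex_potential Ev Od \<Gamma> \<delta> \<eta> \<xi>"
    unfolding vertex_potential_def
  proof (intro conjI ballI)
    show "\<eta> i > 0" if "i \<in> Ev" for i using pos that 0 by (simp add: \<eta>_def)
    show "\<xi> j > 0" if "j \<in> Od" for j using pos that 0 by (simp add: \<xi>_def)
    show "case e of (i, j) \<Rightarrow> \<delta> i j = \<xi> j / \<eta> i" if "e \<in> bip_edges Ev Od \<Gamma>" for e
      using that ext eq by (auto simp: bip_edges_def)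
  qed
  then show thesis using eq by (rule that)
qed

text \<open>The common scaling factor of the two weightings cancels in
  \<open>\<xi> / \<eta>\<close>.\<close>

lemma complete_extension_unique:
  assumes "bipartite_graph Ev Od \<Gamma>" "Digraph_Component.connected (with_proj \<Gamma>)"
    and "complete_extension Ev Od \<Gamma> \<delta> d" "complete_extension Ev Od \<Gamma> \<delta> d'"
    and "i \<in> Ev" "j \<in> Od"
  shows "d' i j = d i j"
proof -
  obtain \<eta> \<xi> where p: "vertex_potential Ev Od \<Gamma> \<delta> \<eta> \<xi>"
    and d: "\<And>i j. i \<in> Ev \<Longrightarrow> j \<in> Od \<Longrightarrow> d i j = \<xi> j / \<eta> i"
    using assms(3) by (rule complete_extension_imp_vertex_potential) blast
  obtain \<eta>' \<xi>' where p': "vertex_potential Ev Od \<Gamma> \<delta> \<eta>' \<xi>'"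
    and d': "\<And>i j. i \<in> Ev \<Longrightarrow> j \<in> Od \<Longrightarrow> d' i j = \<xi>' j / \<eta>' i"
    using assms(4) by (rule complete_extension_imp_vertex_potential) blast
  obtain c where "c > 0" "\<forall>i\<in>Ev. \<eta>' i = c * \<eta> i" "\<forall>j\<in>Od. \<xi>' j = c * \<xi> j"
    using vertex_potential_unique [OF assms(1,2) p p'] by blast
  then show ?thesis using assms(5,6) d d' by simp
qed

text \<open>Composing \<open>v\<close> to \<open>r\<close> with \<open>r\<close> to \<open>s\<close>
  shows that the values of \<open>D\<close> on morphisms out of \<open>v\<close> determine all
  others. The base \<open>v\<close> may have either parity, and \<open>D v\<close> serves as both
  weightings.\<close>

lemma groupoid_extension_potential:
  assumes "groupoid_extension Ev Od \<Gamma> \<delta> D" and v: "v \<in> Ev \<union> Od"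
  shows "vertex_potential Ev Od \<Gamma> \<delta> (D v) (D v)"
    and "\<lbrakk>r \<in> Ev \<union> Od; s \<in> Ev \<union> Od\<rbrakk> \<Longrightarrow> D r s = D v s / D v r"
proof -
  have pos: "D r s > 0" if "r \<in> Ev \<union> Od" "s \<in> Ev \<union> Od" for r s
    using assms(1) that by (auto simp: groupoid_extension_def groupoid_hom_def)
  have quot: "D r s = D v s / D v r" if "r \<in> Ev \<union> Od" "s \<in> Ev \<union> Od" for r s
  proof -
    have "D v r * D r s = D v s"
      using assms that unfolding groupoid_extension_def groupoid_hom_def by blast
    then show ?thesis using pos [OF v that(1)] by (simp add: field_simps)
  qed
  show "\<lbrakk>r \<in> Ev \<union> Od; s \<in> Ev \<union> Od\<rbrakk> \<Longrightarrow> D r s = D v s / D v r" by (rule quot)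
  have "\<delta> i j = D v j / D v i" if "(i, j) \<in> bip_edges Ev Od \<Gamma>" for i j
  proof -
    have "\<delta> i j = D i j"
      using assms(1) that by (fastforce simp: groupoid_extension_def extends_def)
    also have "\<dots> = D v j / D v i" using that by (intro quot) (auto simp: bip_edges_def)
    finally show ?thesis .
  qed
  then show "vertex_potential Ev Od \<Gamma> \<delta> (D v) (D v)"
    using pos v by (auto simp: vertex_potential_def)
qed

lemma groupoid_extension_unique:
  assumes "bipartite_graph Ev Od \<Gamma>" "Digraph_Component.connected (with_proj \<Gamma>)"
    and D: "groupoid_extension Ev Od \<Gamma> \<delta> D" and D': "groupoid_extension Ev Od \<Gamma> \<delta> D'"
    and rs: "r \<in> Ev \<union> Od" "s \<in> Ev \<union> Od"
  shows "D' r s = D r s"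
proof -
  \<comment> \<open>Both homomorphisms are viewed from the base \<open>r\<close>; the factor
    \<open>c\<close> drops out of the quotients.\<close>
  obtain c where "c > 0" "\<forall>v\<in>Ev \<union> Od. D' r v = c * D r v"
    using vertex_potential_unique [OF assms(1,2) groupoid_extension_potential(1) [OF D rs(1)]
        groupoid_extension_potential(1) [OF D' rs(1)]] by blast
  then have "D' r s / D' r r = D r s / D r r" using rs by simp
  then show ?thesis
    using groupoid_extension_potential(2) [OF D rs(1) rs]
      groupoid_extension_potential(2) [OF D' rs(1) rs] by simp
qed

theorem lemma3p16:
  fixes \<Gamma> :: "'v pair_pre_digraph" and Ev Od :: "'v set" and a b :: nat
    and \<delta> :: "'v \<Rightarrow> 'v \<Rightarrow> real"
  assumes bip: "bipartite_graph Ev Od \<Gamma>"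
    and conn: "Digraph_Component.connected (with_proj \<Gamma>)"
    and "card Ev = a" and "card Od = b"
    and pos: "edge_weighting (bip_edges Ev Od \<Gamma>) \<delta>"
  shows
    "(cycle_condition Ev Od \<Gamma> \<delta> \<longleftrightarrow> (\<exists>\<eta> \<xi>. vertex_potential Ev Od \<Gamma> \<delta> \<eta> \<xi>)) \<and>
     ((\<exists>\<eta> \<xi>. vertex_potential Ev Od \<Gamma> \<delta> \<eta> \<xi>) \<longleftrightarrow> (\<exists>d. complete_extension Ev Od \<Gamma> \<delta> d)) \<and>
     ((\<exists>d. complete_extension Ev Od \<Gamma> \<delta> d) \<longleftrightarrow> (\<exists>D. groupoid_extension Ev Od \<Gamma> \<delta> D)) \<and>
     (\<forall>\<eta> \<xi> \<eta>' \<xi>'. vertex_potential Ev Od \<Gamma> \<delta> \<eta> \<xi> \<and> vertex_potential Ev Od \<Gamma> \<delta> \<eta>' \<xi>' \<longrightarrow>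
        (\<exists>c>0. (\<forall>i\<in>Ev. \<eta>' i = c * \<eta> i) \<and> (\<forall>j\<in>Od. \<xi>' j = c * \<xi> j))) \<and>
     (\<forall>d d'. complete_extension Ev Od \<Gamma> \<delta> d \<and> complete_extension Ev Od \<Gamma> \<delta> d' \<longrightarrow>
        (\<forall>i\<in>Ev. \<forall>j\<in>Od. d' i j = d i j)) \<and>
     (\<forall>D D'. groupoid_extension Ev Od \<Gamma> \<delta> D \<and> groupoid_extension Ev Od \<Gamma> \<delta> D' \<longrightarrow>
        (\<forall>r\<in>Ev \<union> Od. \<forall>s\<in>Ev \<union> Od. D' r s = D r s))"
proof -
  have disj: "Ev \<inter> Od = {}" using bip by (simp add: bipartite_graph_def)
  have 12: "cycle_condition Ev Od \<Gamma> \<delta> \<longleftrightarrow> (\<exists>\<eta> \<xi>. vertex_potential Ev Od \<Gamma> \<delta> \<eta> \<xi>)"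
    using cycle_condition_imp_vertex_potential [OF bip conn pos]
      vertex_potential_imp_cycle_condition by blast
  \<comment> \<open>The implications from (2) to (4) to (3) and back to (2) make these three
    conditions equivalent.\<close>
  have 24: "\<exists>D. groupoid_extension Ev Od \<Gamma> \<delta> D"
    if "\<exists>\<eta> \<xi>. vertex_potential Ev Od \<Gamma> \<delta> \<eta> \<xi>"
    using that vertex_potential_imp_groupoid_extension [OF disj] by blast
  have 43: "\<exists>d. complete_extension Ev Od \<Gamma> \<delta> d" if "\<exists>D. groupoid_extension Ev Od \<Gamma> \<delta> D"
    using that groupoid_extension_imp_complete_extension by blast
  have 32: "\<exists>\<eta> \<xi>. vertex_potential Ev Od \<Gamma> \<delta> \<eta> \<xi>" if "\<exists>d. complete_extension Ev Od \<Gamma> \<delta> d"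
    using that complete_extension_imp_vertex_potential by metis
  show ?thesis
    using 12 24 43 32 vertex_potential_unique [OF bip conn]
      complete_extension_unique [OF bip conn] groupoid_extension_unique [OF bip conn]
    by (intro conjI) blast+
qed

end
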